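(* Let $(\mathfrak g,[\cdot,\cdot,\cdot],T)$ be a Rota-Baxter $3$-Lie algebra of weight $\lambda$ and let $(M,\rho,T_M)$ be a representation of it. Then the family of maps $\Phi^n: C^n(\mathfrak g,M)\to C^n(\mathfrak g_T,M)$, $n\ge 0$, defined in the context, is a chain map from the complex $(C^\bullet(\mathfrak g,M),\delta)$ to the complex $(C^\bullet(\mathfrak g_T,M),\partial)$; that is, $\partial^n\circ\Phi^n=\Phi^{n+1}\circ\delta^n$ for all $n\ge 0$.
   Context: Let $k$ be a field of characteristic $0$; vector spaces and tensor products are over $k$; $\lambda\in k$. A $3$-Lie algebra is a vector space $\mathfrak g$ with a linear map $[\cdot,\cdot,\cdot]:\wedge^3\mathfrak g\to\mathfrak g$ such that $[x_1,x_2,[x_3,x_4,x_5]]=[[x_1,x_2,x_3],x_4,x_5]+[x_3,[x_1,x_2,x_4],x_5]+[x_3,x_4,[x_1,x_2,x_5]]$. A representation of $\mathfrak g$ on a vector space $M$ is a linear map $\rho:\wedge^2\mathfrak g\to\mathfrak{gl}(M)$ with $\rho(x_1,x_2)\rho(x_3,x_4)=\rho([x_1,x_2,x_3],x_4)+\rho(x_3,[x_1,x_2,x_4])+\rho(x_3,x_4)\rho(x_1,x_2)$ and $\rho(x_1,[x_2,x_3,x_4])=\rho(x_3,x_4)\rho(x_1,x_2)-\rho(x_2,x_4)\rho(x_1,x_3)+\rho(x_2,x_3)\rho(x_1,x_4)$. A Rota-Baxter $3$-Lie algebra of weight $\lambda$ is a $3$-Lie algebra with a linear map $T:\mathfrak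 g\to\mathfrak g$ such that $[T(x),T(y),T(z)]=T([x,y,z]_T)$, where $[x,y,z]_T:=[T(x),T(y),z]+[T(x),y,T(z)]+[x,T(y),T(z)]+\lambda[T(x),y,z]+\lambda[x,T(y),z]+\lambda[x,y,T(z)]+\lambda^2[x,y,z]$. A representation of it is a triple $(M,\rho,T_M)$ where $(M,\rho)$ is a representation of the $3$-Lie algebra and $T_M:M\to M$ is linear with $\rho(T(x),T(y))T_M(m)=T_M\big(\rho(T(x),T(y))m+\rho(T(x),y)T_M(m)+\rho(x,T(y))T_M(m)+\lambda\rho(T(x),y)m+\lambda\rho(x,T(y))m+\lambda\rho(x,y)T_M(m)+\lambda^2\rho(x,y)m\big)$. It is known that $\mathfrak g_T:=(\mathfrak g,[\cdot,\cdot,\cdot]_T)$ is a $3$-Lie algebra and that $\rho_T(x,y)m:=\rho(T(x),T(y))m-T_M\big(\rho(T(x),y)m+\rho(x,T(y))m+\lambda\rho(x,y)m\big)$ defines a representation of $\mathfrak g_T$ on $M$. Cochains: $C^0(\mathfrak g,M)=M$, $C^1(\mathfrak g,M)=\mathrm{Hom}(\mathfrak g,M)$, and for $n\ge2$, $C^n(\mathfrak g,M)=\mathrm{Hom}((\wedge^2\mathfrak g)^{\otimes(n-2)}\otimes\wedge^3\mathfrak g,M)$ (often written $\mathrm{Hom}(\wedge^2\mathfrak g\otimes\cdots\otimes\wedge^2\mathfrak g\wedge\mathfrak g,M)$ with $n-1$ factors $\wedge^2\mathfrak g$). An $f\in C^n$ is evaluated as $f(X_1,\dots,X_{n-1},x_n)$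 with $X_i=x_i\wedge y_i$, skew-symmetric in $x_{n-1},y_{n-1},x_n$. For $n\ge1$, $$\begin{aligned}(\delta^nf)(X_1,\dots,X_n,x_{n+1})=&\sum_{1\le j<k\le n}(-1)^jf(X_1,\dots,\hat X_j,\dots,X_{k-1},[x_j,y_j,x_k]\wedge y_k+x_k\wedge[x_j,y_j,y_k],X_{k+1},\dots,X_n,x_{n+1})\\&+\sum_{j=1}^n(-1)^jf(X_1,\dots,\hat X_j,\dots,X_n,[x_j,y_j,x_{n+1}])\\&+\sum_{j=1}^n(-1)^{j-1}\rho(x_j,y_j)f(X_1,\dots,\hat X_j,\dots,X_n,x_{n+1})\\&+(-1)^{n+1}\big(\rho(y_n,x_{n+1})f(X_1,\dots,X_{n-1},x_n)+\rho(x_{n+1},x_n)f(X_1,\dots,X_{n-1},y_n)\big),\end{aligned}$$ and $\delta^0=0$. The complex $(C^\bullet(\mathfrak g_T,M),\partial)$ has the same cochain spaces, and $\partial^n$ is given by the same formulas with $[\cdot,\cdot,\cdot]$ and $\rho$ replaced by $[\cdot,\cdot,\cdot]_T$ and $\rho_T$. Definition of $\Phi$: $\Phi^0=\mathrm{Id}_M$, $\Phi^1(f)=f\circ T-T_M\circ f$, and for $n\ge2$, writing a cochain as a multilinear function of the $2n-1$ arguments $(z_1,\dots,z_{2n-1})=(x_1,y_1,\dots,x_{n-1},y_{n-1},x_n)$, $$\Phi^n(f)(z_1,\dots,z_{2n-1})=f(T(z_1),\dots,T(z_{2n-1}))-\sum_{k=0}^{2n-2}\lambda^{2n-2-k}\sum_{1\le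 i_1<\dots<i_k\le 2n-1}T_M\big(f(z_1,\dots,T(z_{i_1}),\dots,T(z_{i_k}),\dots,z_{2n-1})\big),$$ where in the inner sum $T$ is applied exactly to the arguments in positions $i_1,\dots,i_k$ (and $\lambda^0=1$). *)

theory Defs
  imports Main "HOL.Vector_Spaces"
begin

section \<open>3-Lie algebras, Rota-Baxter operators and representations\<close>

text \<open>
  A linear map on an exterior power is rendered as a map that is linear in each argument and
  vanishes as soon as two arguments (of the same exterior power) coincide.
\<close>

locale three_lie_algebra = vector_space scaleG
  for scaleG :: "'k::field_char_0 \<Rightarrow> 'g::ab_group_add \<Rightarrow> 'g" +
  fixes br :: "'g \<Rightarrow> 'g \<Rightarrow> 'g \<Rightarrow> 'g"
  assumes br_linear1: "Vector_Spaces.linear scaleG scaleG (\<lambda>x. br x y z)"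
    and br_linear2: "Vector_Spaces.linear scaleG scaleG (\<lambda>y. br x y z)"
    and br_linear3: "Vector_Spaces.linear scaleG scaleG (\<lambda>z. br x y z)"
    and br_alt12: "br x x y = 0"
    and br_alt13: "br x y x = 0"
    and br_alt23: "br y x x = 0"
    and fundamental_identity:
      "br x1 x2 (br x3 x4 x5) =
         br (br x1 x2 x3) x4 x5 + br x3 (br x1 x2 x4) x5 + br x3 x4 (br x1 x2 x5)"

locale three_lie_representation =
  three_lie_algebra scaleG br + M: vector_space scaleM
  for scaleG :: "'k::field_char_0 \<Rightarrow> 'g::ab_group_add \<Rightarrow> 'g"
    and br :: "'g \<Rightarrow> 'g \<Rightarrow> 'g \<Rightarrow> 'g"
    and scaleM :: "'k \<Rightarrow> 'm::ab_group_add \<Rightarrow> 'm" +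
  fixes \<rho> :: "'g \<Rightarrow> 'g \<Rightarrow> 'm \<Rightarrow> 'm"
  assumes rho_linear1: "Vector_Spaces.linear scaleG scaleM (\<lambda>x. \<rho> x y m)"
    and rho_linear2: "Vector_Spaces.linear scaleG scaleM (\<lambda>y. \<rho> x y m)"
    and rho_linear3: "Vector_Spaces.linear scaleM scaleM (\<rho> x y)"
    and rho_alt: "\<rho> x x m = 0"
    and rho_comm:
      "\<rho> x1 x2 (\<rho> x3 x4 m) =
         \<rho> (br x1 x2 x3) x4 m + \<rho> x3 (br x1 x2 x4) m + \<rho> x3 x4 (\<rho> x1 x2 m)"
    and rho_br:
      "\<rho> x1 (br x2 x3 x4) m =
         \<rho> x3 x4 (\<rho> x1 x2 m) - \<rho> x2 x4 (\<rho> x1 x3 m) + \<rho> x2 x3 (\<rho> x1 x4 m)"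

definition br_T :: "('k::field_char_0 \<Rightarrow> 'g::ab_group_add \<Rightarrow> 'g) \<Rightarrow> ('g \<Rightarrow> 'g \<Rightarrow> 'g \<Rightarrow> 'g)
    \<Rightarrow> 'k \<Rightarrow> ('g \<Rightarrow> 'g) \<Rightarrow> 'g \<Rightarrow> 'g \<Rightarrow> 'g \<Rightarrow> 'g" where
  "br_T scaleG br lam T x y z =
     br (T x) (T y) z + br (T x) y (T z) + br x (T y) (T z)
     + scaleG lam (br (T x) y z) + scaleG lam (br x (T y) z) + scaleG lam (br x y (T z))
     + scaleG (lam^2) (br x y z)"

definition rho_T :: "('k::field_char_0 \<Rightarrow> 'm::ab_group_add \<Rightarrow> 'm) \<Rightarrow> ('g \<Rightarrow> 'g \<Rightarrow> 'm \<Rightarrow> 'm)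
    \<Rightarrow> 'k \<Rightarrow> ('g \<Rightarrow> 'g) \<Rightarrow> ('m \<Rightarrow> 'm) \<Rightarrow> 'g \<Rightarrow> 'g \<Rightarrow> 'm \<Rightarrow> 'm" where
  "rho_T scaleM \<rho> lam T TM x y m =
     \<rho> (T x) (T y) m - TM (\<rho> (T x) y m + \<rho> x (T y) m + scaleM lam (\<rho> x y m))"

locale rota_baxter_three_lie_algebra = three_lie_algebra scaleG br
  for scaleG :: "'k::field_char_0 \<Rightarrow> 'g::ab_group_add \<Rightarrow> 'g"
    and br :: "'g \<Rightarrow> 'g \<Rightarrow> 'g \<Rightarrow> 'g" +
  fixes lam :: 'k and T :: "'g \<Rightarrow> 'g"
  assumes T_linear: "Vector_Spaces.linear scaleG scaleG T"
    and rota_baxter: "br (T x) (T y) (T z) = T (br_T scaleG br lam T x y z)"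

locale rota_baxter_three_lie_representation =
  rota_baxter_three_lie_algebra scaleG br lam T + three_lie_representation scaleG br scaleM \<rho>
  for scaleG :: "'k::field_char_0 \<Rightarrow> 'g::ab_group_add \<Rightarrow> 'g"
    and br :: "'g \<Rightarrow> 'g \<Rightarrow> 'g \<Rightarrow> 'g"
    and lam :: 'k and T :: "'g \<Rightarrow> 'g"
    and scaleM :: "'k \<Rightarrow> 'm::ab_group_add \<Rightarrow> 'm"
    and \<rho> :: "'g \<Rightarrow> 'g \<Rightarrow> 'm \<Rightarrow> 'm" +
  fixes TM :: "'m \<Rightarrow> 'm"
  assumes TM_linear: "Vector_Spaces.linear scaleM scaleM TM"
    and rota_baxter_rep:
      "\<rho> (T x) (T y) (TM m) =
         TM (\<rho> (T x) (T y) m + \<rho> (T x) y (TM m) + \<rho> x (T y) (TM m)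
           + scaleM lam (\<rho> (T x) y m) + scaleM lam (\<rho> x (T y) m)
           + scaleM lam (\<rho> x y (TM m)) + scaleM (lam^2) (\<rho> x y m))"


section \<open>Cochains\<close>

text \<open>
  An \<open>n\<close>-cochain (\<open>n \<ge> 1\<close>) is a multilinear function of the \<open>2n - 1\<close> arguments
  \<open>(x\<^sub>1, y\<^sub>1, \<dots>, x\<^bsub>n-1\<^esub>, y\<^bsub>n-1\<^esub>, x\<^sub>n)\<close>, given as the list of these arguments; list positions count
  from 0. Since \<open>2 * 0 - 1 = 0\<close> on the naturals, a 0-cochain is a function on the empty list
  only, i.e. an element of \<open>M\<close>. On lists of any other length cochains are 0, so that equality
  of cochains is equality of functions.
\<close>

definition num_args :: "nat \<Rightarrow> nat" where
  "num_args n = 2 * n - 1"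

text \<open>
  Positions \<open>i < j\<close> belong to the same exterior power in
  \<open>(\<wedge>\<^sup>2 \<otimes> \<dots> \<otimes> \<wedge>\<^sup>2) \<otimes> \<wedge>\<^sup>3\<close>, with \<open>n - 2\<close> factors \<open>\<wedge>\<^sup>2\<close>: they are
  \<open>x\<^sub>p, y\<^sub>p\<close> for some \<open>p\<close>, or both are among the last three. For \<open>n \<le> 1\<close> there are no such
  positions below \<open>num_args n\<close>.
\<close>

definition same_factor :: "nat \<Rightarrow> nat \<Rightarrow> nat \<Rightarrow> bool" where
  "same_factor n i j \<longleftrightarrow> i < j \<and> j < num_args n \<and> ((even i \<and> j = i + 1) \<or> num_args n \<le> i + 3)"

definition cochains :: "('k::field_char_0 \<Rightarrow> 'g::ab_group_add \<Rightarrow> 'g)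
    \<Rightarrow> ('k \<Rightarrow> 'm::ab_group_add \<Rightarrow> 'm) \<Rightarrow> nat \<Rightarrow> ('g list \<Rightarrow> 'm) set" where
  "cochains scaleG scaleM n = {f.
     (\<forall>zs. length zs \<noteq> num_args n \<longrightarrow> f zs = 0) \<and>
     (\<forall>zs i. length zs = num_args n \<and> i < num_args n \<longrightarrow>
        Vector_Spaces.linear scaleG scaleM (\<lambda>z. f (zs[i := z]))) \<and>
     (\<forall>zs i j. length zs = num_args n \<and> same_factor n i j \<and> zs ! i = zs ! j \<longrightarrow> f zs = 0)}"

text \<open>Remove \<open>X\<^sub>j = x\<^sub>j \<wedge> y\<^sub>j\<close>, where \<open>j \<ge> 1\<close> as in the usual numbering.\<close>

definition omit :: "nat \<Rightarrow> 'g list \<Rightarrow> 'g list" where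
  "omit j zs = take (2 * j - 2) zs @ drop (2 * j) zs"

text \<open>
  Below, \<open>x j\<close> (\<open>1 \<le> j \<le> n + 1\<close>) and \<open>y j\<close> (\<open>1 \<le> j \<le> n\<close>) are the arguments of
  \<open>(\<delta>\<^sup>n f)(X\<^sub>1, \<dots>, X\<^sub>n, x\<^bsub>n+1\<^esub>)\<close>. The entry
  \<open>[x\<^sub>j, y\<^sub>j, x\<^sub>k] \<wedge> y\<^sub>k + x\<^sub>k \<wedge> [x\<^sub>j, y\<^sub>j, y\<^sub>k]\<close> at position \<open>k\<close> gives two values of \<open>f\<close>.
\<close>

definition coboundary :: "('g::ab_group_add \<Rightarrow> 'g \<Rightarrow> 'g \<Rightarrow> 'g)
    \<Rightarrow> ('k::field_char_0 \<Rightarrow> 'm::ab_group_add \<Rightarrow> 'm) \<Rightarrow> ('g \<Rightarrow> 'g \<Rightarrow> 'm \<Rightarrow> 'm)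
    \<Rightarrow> nat \<Rightarrow> ('g list \<Rightarrow> 'm) \<Rightarrow> 'g list \<Rightarrow> 'm" where
  "coboundary br scaleM \<rho> n f zs =
     (if n = 0 \<or> length zs \<noteq> num_args (n + 1) then 0
      else
        let x = (\<lambda>j. zs ! (2 * j - 2)); y = (\<lambda>j. zs ! (2 * j - 1)) in
          (\<Sum>k = 1..n. \<Sum>j = 1..<k. scaleM ((-1) ^ j)
             (f (omit j (zs[2 * k - 2 := br (x j) (y j) (x k)]))
              + f (omit j (zs[2 * k - 1 := br (x j) (y j) (y k)]))))
          + (\<Sum>j = 1..n. scaleM ((-1) ^ j)
               (f (omit j (zs[2 * n := br (x j) (y j) (x (n + 1))]))))
          + (\<Sum>j = 1..n. scaleM ((-1) ^ (j - 1)) (\<rho> (x j) (y j) (f (omit j zs))))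
          + scaleM ((-1) ^ (n + 1))
              (\<rho> (y n) (x (n + 1)) (f (take (2 * n - 2) zs @ [x n]))
               + \<rho> (x (n + 1)) (x n) (f (take (2 * n - 2) zs @ [y n]))))"


section \<open>The maps \<open>\<Phi>\<^sup>n\<close>\<close>

definition apply_at :: "('g \<Rightarrow> 'g) \<Rightarrow> nat set \<Rightarrow> 'g list \<Rightarrow> 'g list" where
  "apply_at T S zs = map (\<lambda>i. if i \<in> S then T (zs ! i) else zs ! i) [0..<length zs]"

definition Phi :: "('k::field_char_0 \<Rightarrow> 'm::ab_group_add \<Rightarrow> 'm) \<Rightarrow> 'k \<Rightarrow> ('g \<Rightarrow> 'g) \<Rightarrow> ('m \<Rightarrow> 'm)
    \<Rightarrow> nat \<Rightarrow> ('g list \<Rightarrow> 'm) \<Rightarrow> 'g list \<Rightarrow> 'm" where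
  "Phi scaleM lam T TM n f =
     (if n = 0 then f
      else if n = 1 then (\<lambda>zs. f (map T zs) - TM (f zs))
      else (\<lambda>zs. f (map T zs)
             - (\<Sum>k = 0..2 * n - 2. scaleM (lam ^ (2 * n - 2 - k))
                  (\<Sum>S\<in>{S. S \<subseteq> {..<2 * n - 1} \<and> card S = k}. TM (f (apply_at T S zs))))))"

definition cochain_map :: "('k::field_char_0 \<Rightarrow> 'm::ab_group_add \<Rightarrow> 'm)
    \<Rightarrow> (nat \<Rightarrow> ('a \<Rightarrow> 'm) set) \<Rightarrow> (nat \<Rightarrow> ('a \<Rightarrow> 'm) \<Rightarrow> ('a \<Rightarrow> 'm))
    \<Rightarrow> (nat \<Rightarrow> ('a \<Rightarrow> 'm) set) \<Rightarrow> (nat \<Rightarrow> ('a \<Rightarrow> 'm) \<Rightarrow> ('a \<Rightarrow> 'm))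
    \<Rightarrow> (nat \<Rightarrow> ('a \<Rightarrow> 'm) \<Rightarrow> ('a \<Rightarrow> 'm)) \<Rightarrow> bool" where
  "cochain_map scaleM C d D e F \<longleftrightarrow>
     (\<forall>n. \<forall>f\<in>C n. F n f \<in> D n) \<and>
     (\<forall>n. \<forall>f\<in>C n. \<forall>g\<in>C n. F n (\<lambda>z. f z + g z) = (\<lambda>z. F n f z + F n g z)) \<and>
     (\<forall>n. \<forall>f\<in>C n. \<forall>c. F n (\<lambda>z. scaleM c (f z)) = (\<lambda>z. scaleM c (F n f z))) \<and>
     (\<forall>n. \<forall>f\<in>C n. e n (F n f) = F (n + 1) (d n f))"

end

theory Submission
  imports Defs
begin

text \<open>
  Regard a cochain as a function \<open>g\<close> of a family \<open>z\<close> of arguments indexed by a finite set \<open>I\<close>, so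
  that \<open>\<Phi> g z = g (T z) - TM (R I g z)\<close>, where \<open>R I g z\<close> is the sum of
  \<open>\<lambda>\<^bsup>card I - 1 - card S\<^esup> g (T\<^sub>S z)\<close> over the proper subsets \<open>S\<close> of \<open>I\<close> and \<open>T\<^sub>S\<close> applies \<open>T\<close> to the
  arguments in \<open>S\<close>. Splitting the subsets by whether they contain a given index \<open>i\<close> gives the
  recursion, for \<open>i \<notin> I\<close>, \<open>R (I \<union> {i}) g z = R I g (T\<^sub>i z) + g (T\<^sub>I z) + \<lambda> R I g z\<close>. Expanding it at the three
  arguments of a bracket, or at the two arguments of \<open>\<rho>\<close>, produces exactly \<open>[_, _, _]\<^sub>T\<close> and
  \<open>\<rho>\<^sub>T\<close>, so \<open>\<partial>\<Phi> f\<close> and \<open>\<Phi>\<delta> f\<close> agree summand by summand: there is no cancellation between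
  different summands of the coboundary, and only the Rota-Baxter identities are needed.
\<close>

section \<open>Linear maps, and the coboundary evaluated on an indexed family\<close>

lemma linear_addD: "Vector_Spaces.linear s1 s2 f \<Longrightarrow> f (x + y) = f x + f y"
  by (blast dest: Vector_Spaces.linear.axioms(3) module_hom.add)

lemma linear_scaleD: "Vector_Spaces.linear s1 s2 f \<Longrightarrow> f (s1 c x) = s2 c (f x)"
  by (blast dest: Vector_Spaces.linear.axioms(3) module_hom.scale)

lemma linear_diffD: "Vector_Spaces.linear s1 s2 f \<Longrightarrow> f (x - y) = f x - f y"
  by (blast dest: Vector_Spaces.linear.axioms(3) module_hom.diff)

lemma linear_sumD: "Vector_Spaces.linear s1 s2 f \<Longrightarrow> f (sum g A) = (\<Sum>a\<in>A. f (g a))"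
  by (blast dest: Vector_Spaces.linear.axioms(3) module_hom.sum)

lemma linear_zeroD: "Vector_Spaces.linear s1 s2 f \<Longrightarrow> f 0 = 0"
  by (blast dest: Vector_Spaces.linear.axioms(3) module_hom.zero)

lemma map_upt_list_update:
  "(map z [0..<N])[r := v] = map (z(r := v)) [0..<N]"
  by (rule nth_equalityI) (auto simp: nth_list_update)

lemma omit_map_upt:
  assumes "1 \<le> j" "j \<le> n"
  shows "omit j (map z [0..<2 * n + 1]) = map z ([0..<2 * j - 2] @ [2 * j..<2 * n + 1])"
  using assms by (simp add: omit_def take_map drop_map)

text \<open>Every value of \<open>f\<close> is brought to the form \<open>f (map z' idx)\<close>:
  omitting a pair shortens the index list, and inserting a bracket updates the family. In this form
  each summand can be compared by means of \<open>phi_fun\<close>.\<close>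

lemma coboundary_map_upt:
  assumes "n \<noteq> 0"
  defines "w \<equiv> (\<lambda>j. [0..<2 * j - 2] @ [2 * j..<2 * n + 1])"
  shows "coboundary b s r n f (map z [0..<2 * n + 1]) =
      (\<Sum>k = 1..n. \<Sum>j = 1..<k. s ((-1) ^ j)
        (f (map (z(2*k-2 := b (z (2*j-2)) (z (2*j-1)) (z (2*k-2)))) (w j))
         + f (map (z(2*k-1 := b (z (2*j-2)) (z (2*j-1)) (z (2*k-1)))) (w j))))
      + (\<Sum>j = 1..n. s ((-1) ^ j)
        (f (map (z(2*n := b (z (2*j-2)) (z (2*j-1)) (z (2*n)))) (w j))))
      + (\<Sum>j = 1..n. s ((-1) ^ (j - 1)) (r (z (2*j-2)) (z (2*j-1)) (f (map z (w j)))))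
      + s ((-1) ^ (n + 1))
          (r (z (2*n-1)) (z (2*n)) (f (map z ([0..<2*n-2] @ [2*n-2])))
           + r (z (2*n)) (z (2*n-2)) (f (map z ([0..<2*n-2] @ [2*n-1]))))"
proof -
  have nth: "map z [0..<2 * n + 1] ! i = z i" if "i \<le> 2 * n" for i
    using that by (simp del: upt_Suc)
  have om: "omit j (map y [0..<2 * n + 1]) = map y (w j)" if "1 \<le> j" "j \<le> n" for j y
    unfolding w_def by (rule omit_map_upt) (use that in auto)
  then have om': "omit j (map y [0..<Suc (2 * n)]) = map y (w j)" if "1 \<le> j" "j \<le> n" for j y
    using that by simp
  have len: "length (map z [0..<2 * n + 1]) = num_args (n + 1)"
    by (simp add: num_args_def)
  have tk: "take (2 * n - 2) (map z [0..<2 * n + 1]) = map z [0..<2*n-2]"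
    by (simp add: take_map del: upt_Suc)
  have nz: "\<not> (n = 0 \<or> length (map z [0..<2 * n + 1]) \<noteq> num_args (n + 1))"
    using assms(1) len by simp
  have x_last: "2 * (n + 1) - 2 = 2 * n" by simp
  show ?thesis
    unfolding coboundary_def if_not_P[OF nz] Let_def map_upt_list_update tk x_last
    using assms(1)
    by (intro arg_cong2[where f = "(+)"] sum.cong refl arg_cong[where f = "s _"])
      (auto simp: om' nth simp del: upt_Suc)
qed

section \<open>Twisted sums over proper subsets of an index set\<close>

context rota_baxter_three_lie_representation
begin

text \<open>Arguments are indexed rather than listed, so that changing one is a function update and
  dropping some leaves the indices of the others unchanged.\<close>

definition twist :: "'i set \<Rightarrow> ('i \<Rightarrow> 'g) \<Rightarrow> 'i \<Rightarrow> 'g" where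
  "twist S z = (\<lambda>i. if i \<in> S then T (z i) else z i)"

text \<open>The exponent is not truncated: a proper subset of a finite \<open>I\<close> has at most
  \<open>card I - 1\<close> elements. For empty \<open>I\<close> the sum is 0.\<close>

definition rb_sum :: "'i set \<Rightarrow> (('i \<Rightarrow> 'g) \<Rightarrow> 'm) \<Rightarrow> ('i \<Rightarrow> 'g) \<Rightarrow> 'm" where
  "rb_sum I g z =
     (\<Sum>S\<in>Pow I - {I}. scaleM (lam ^ (card I - 1 - card S)) (g (twist S z)))"

definition phi_fun :: "'i set \<Rightarrow> (('i \<Rightarrow> 'g) \<Rightarrow> 'm) \<Rightarrow> ('i \<Rightarrow> 'g) \<Rightarrow> 'm" where
  "phi_fun I g z = g (T \<circ> z) - TM (rb_sum I g z)"

lemma twist_fun_upd: "i \<notin> S \<Longrightarrow> twist S (z(i := v)) = (twist S z)(i := v)"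
  by (auto simp: twist_def)

lemma twist_insert: "i \<notin> S \<Longrightarrow> twist (insert i S) z = twist S (z(i := T (z i)))"
  by (auto simp: twist_def)

text \<open>A proper subset of \<open>insert i J\<close> is either \<open>insert i S\<close> with
  \<open>S\<close> a proper subset of \<open>J\<close>, or any subset of \<open>J\<close>. The first
  kind keeps its exponent. Of the second kind, \<open>J\<close> itself has exponent 0, and each
  proper subset gains one factor \<open>lam\<close>.\<close>

lemma rb_sum_insert:
  assumes "finite J" "i \<notin> J"
  shows "rb_sum (insert i J) g z =
    rb_sum J g (z(i := T (z i))) + g (twist J z) + scaleM lam (rb_sum J g z)"
proof -
  let ?h = "\<lambda>S. scaleM (lam ^ (card J - card S)) (g (twist S z))"
  have dec: "Pow (insert i J) - {insert i J} = insert i ` (Pow J - {J}) \<union> Pow J"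
    using assms(2) by (auto simp: Pow_insert)
  have inj: "inj_on (insert i) (Pow J - {J})"
    using assms(2) by (auto simp: inj_on_def)
  have "rb_sum (insert i J) g z = (\<Sum>S\<in>Pow (insert i J) - {insert i J}. ?h S)"
    using assms by (simp add: rb_sum_def)
  also have "\<dots> = sum ?h (insert i ` (Pow J - {J})) + sum ?h (Pow J)"
    unfolding dec by (rule sum.union_disjoint) (use assms in auto)
  also have "sum ?h (insert i ` (Pow J - {J})) = rb_sum J g (z(i := T (z i)))"
    unfolding rb_sum_def sum.reindex[OF inj] o_def
  proof (rule sum.cong[OF refl])
    fix S assume S: "S \<in> Pow J - {J}"
    then have "i \<notin> S" "finite S" using assms finite_subset by auto
    then show "?h (insert i S) =
      scaleM (lam ^ (card J - 1 - card S)) (g (twist S (z(i := T (z i)))))"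
      by (simp add: twist_insert)
  qed
  also have "sum ?h (Pow J) = ?h J + sum ?h (Pow J - {J})"
    by (rule sum.remove) (use assms in auto)
  also have "sum ?h (Pow J - {J}) = scaleM lam (rb_sum J g z)"
    unfolding rb_sum_def M.scale_sum_right
  proof (rule sum.cong[OF refl])
    fix S assume S: "S \<in> Pow J - {J}"
    then have "card S < card J"
      using assms(1) by (auto intro: psubset_card_mono)
    then have "lam ^ (card J - card S) = lam * lam ^ (card J - 1 - card S)"
      by (simp flip: power_Suc add: Suc_diff_Suc)
    then show "?h S = scaleM lam (scaleM (lam ^ (card J - 1 - card S)) (g (twist S z)))"
      by simp
  qed
  finally show ?thesis by (simp only: add.assoc diff_self_eq_0 power_0 M.scale_one)
qed

lemma rb_sum_cong:
  assumes "\<And>S. S \<subseteq> J \<Longrightarrow> g (twist S z) = g' (twist S z')"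
  shows "rb_sum J g z = rb_sum J g' z'"
  unfolding rb_sum_def by (rule sum.cong) (use assms in auto)

lemma rb_sum_add: "rb_sum I (\<lambda>z. g z + h z) z = rb_sum I g z + rb_sum I h z"
  by (simp add: rb_sum_def M.scale_right_distrib sum.distrib)

lemma rb_sum_linear:
  assumes "Vector_Spaces.linear scaleM scaleM L"
  shows "rb_sum I (\<lambda>z. L (g z)) z = L (rb_sum I g z)"
  by (simp add: rb_sum_def linear_sumD[OF assms] linear_scaleD[OF assms])

lemma linear_scaleM: "Vector_Spaces.linear scaleM scaleM (scaleM c)"
  by (rule M.linear_scale_self)

lemma phi_fun_add: "phi_fun I (\<lambda>z. g z + h z) z = phi_fun I g z + phi_fun I h z"
  by (simp add: phi_fun_def rb_sum_add linear_addD[OF TM_linear])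

lemma phi_fun_scale: "phi_fun I (\<lambda>z. scaleM c (g z)) z = scaleM c (phi_fun I g z)"
  by (simp add: phi_fun_def rb_sum_linear[OF linear_scaleM] linear_scaleD[OF TM_linear]
      M.scale_right_diff_distrib)

lemma phi_fun_zero: "phi_fun I (\<lambda>z. 0) z = 0"
  by (simp add: phi_fun_def rb_sum_def linear_zeroD[OF TM_linear])

lemma phi_fun_sum: "phi_fun I (\<lambda>z. \<Sum>a\<in>A. g a z) z = (\<Sum>a\<in>A. phi_fun I (g a) z)"
  by (induction A rule: infinite_finite_induct) (simp_all add: phi_fun_zero phi_fun_add)

section \<open>Multilinearity and alternation of the twisted sums\<close>

lemma linear_slot_rb_sum:
  assumes "i \<notin> J" "\<And>z. Vector_Spaces.linear scaleG scaleM (\<lambda>v. g (z(i := v)))"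
  shows "Vector_Spaces.linear scaleG scaleM (\<lambda>v. rb_sum J g (z(i := v)))"
proof -
  have eq: "rb_sum J g (z(i := v)) =
      (\<Sum>S\<in>Pow J - {J}. scaleM (lam ^ (card J - 1 - card S)) (g ((twist S z)(i := v))))" for v
    unfolding rb_sum_def using assms(1) by (intro sum.cong refl) (subst twist_fun_upd, auto)
  show ?thesis
    unfolding eq
    by (unfold_locales)
      (auto simp: linear_addD[OF assms(2)] linear_scaleD[OF assms(2)] M.scale_right_distrib
        sum.distrib M.scale_sum_right M.scale_left_commute simp del: M.scale_scale)
qed

text \<open>After one recursion step at \<open>i\<close>, the value \<open>v\<close> enters only at
  an index outside \<open>J\<close>, either as \<open>v\<close> or as \<open>T v\<close>, and
  \<open>T\<close> is linear.\<close>

lemma linear_slot_phi_fun: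
  assumes "finite I" "i \<in> I" "\<And>z. Vector_Spaces.linear scaleG scaleM (\<lambda>v. g (z(i := v)))"
  shows "Vector_Spaces.linear scaleG scaleM (\<lambda>v. phi_fun I g (z(i := v)))"
proof -
  define J where "J = I - {i}"
  have I: "I = insert i J" "finite J" "i \<notin> J"
    using assms by (auto simp: J_def)
  note lin = linear_slot_rb_sum[OF I(3) assms(3)]
  have eq: "phi_fun I g (z(i := v)) = g ((T \<circ> z)(i := T v)) -
      TM (rb_sum J g (z(i := T v)) + g ((twist J z)(i := v)) + scaleM lam (rb_sum J g (z(i := v))))"
    for v
    using I by (simp add: phi_fun_def rb_sum_insert twist_fun_upd fun_upd_comp)
  show ?thesis
    unfolding eq
    by (unfold_locales)
      (simp_all add: linear_addD[OF assms(3)] linear_scaleD[OF assms(3)]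
        linear_addD[OF lin] linear_scaleD[OF lin] linear_addD[OF TM_linear]
        linear_scaleD[OF TM_linear] linear_addD[OF T_linear] linear_scaleD[OF T_linear]
        M.scale_right_distrib M.scale_right_diff_distrib M.scale_left_commute algebra_simps
        del: M.scale_scale)
qed

text \<open>Subsets containing both or neither of \<open>i\<close> and \<open>j\<close> leave equal
  values there and contribute 0. Those containing exactly one of them cancel in pairs under exchange
  of \<open>i\<close> and \<open>j\<close>. Skewness is a separate hypothesis because
  \<open>g\<close> is not assumed additive.\<close>

lemma phi_fun_alternating:
  assumes fin: "finite I" and ij: "i \<in> I" "j \<in> I" "i \<noteq> j" "z i = z j"
    and alt: "\<And>z v. g (z(i := v, j := v)) = 0"
    and skew: "\<And>z u v. g (z(i := u, j := v)) + g (z(i := v, j := u)) = 0"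
  shows "phi_fun I g z = 0"
proof -
  define J where "J = I - {i, j}"
  have I: "I = insert i (insert j J)" "finite J" "i \<notin> J" "j \<notin> J"
    using assms by (auto simp: J_def)
  define a where "a = z i"
  define y where "y = (\<lambda>u v. z(i := u, j := v))"
  \<comment> \<open>\<open>L u v\<close> collects the proper subsets of \<open>J\<close> and
    \<open>H u v\<close> the set \<open>J\<close> itself, when \<open>u\<close> and \<open>v\<close>
    stand at \<open>i\<close> and \<open>j\<close>.\<close>
  define L where "L = (\<lambda>u v. rb_sum J g (y u v))"
  define H where "H = (\<lambda>u v. g (twist J (y u v)))"
  have y: "y u v i = u" "y u v j = v" "(y u v)(i := w) = y w v" "(y u v)(j := w) = y u w" for u v w
    using ij(3) by (auto simp: y_def)
  have z: "z = y a a"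
    using ij by (auto simp: y_def a_def)
  have tw: "twist S (y u v) = (twist S z)(i := u, j := v)" if "S \<subseteq> J" for S u v
    using that I ij(3) by (auto simp: y_def twist_def fun_eq_iff)
  have L_alt: "L u u = 0" for u
    unfolding L_def rb_sum_def by (intro sum.neutral) (auto simp: tw alt)
  have L_skew: "L u v + L v u = 0" for u v
    unfolding L_def rb_sum_def sum.distrib[symmetric]
    by (intro sum.neutral) (auto simp: tw skew simp flip: M.scale_right_distrib)
  have H: "H u u = 0" "H u v + H v u = 0" for u v
    by (simp_all add: H_def tw alt skew)
  have "rb_sum I g z = (L (T a) (T a) + H (T a) a + scaleM lam (L (T a) a)) + H a (T a)
      + scaleM lam (L a (T a) + H a a + scaleM lam (L a a))"
    using I ij(3) by (simp add: z rb_sum_insert twist_insert y L_def H_def)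
  also have "\<dots> = (H (T a) a + H a (T a)) + scaleM lam (L (T a) a + L a (T a))"
    by (simp add: L_alt H(1) M.scale_right_distrib algebra_simps)
  also have "\<dots> = 0"
    by (simp only: L_skew H) simp
  finally have "rb_sum I g z = 0" .
  moreover have "T \<circ> z = (T \<circ> z)(i := T a, j := T a)"
    using ij by (auto simp: a_def)
  ultimately show ?thesis
    using alt[of "T \<circ> z" "T a"] by (simp add: phi_fun_def linear_zeroD[OF TM_linear])
qed

section \<open>Brackets and actions under the twisted sums\<close>

text \<open>Recursion at \<open>p\<close>, \<open>q\<close>, \<open>r\<close> runs over the subsets
  of these three. One with \<open>k < 3\<close> elements contributes \<open>lam^(2-k)\<close> times
  \<open>H\<close> and \<open>lam^(3-k)\<close> times \<open>L\<close> of its bracket; together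
  these give \<open>H w + lam L w\<close>, where \<open>w\<close> is the bracket
  \<open>br_T\<close>. The full subset gives \<open>L (T w)\<close> by the Rota-Baxter identity. The
  total is one recursion step at \<open>r\<close> for \<open>h\<close> with value
  \<open>w\<close>.\<close>

lemma phi_fun_bracket:
  assumes fin: "finite J" and p: "p \<notin> insert q (insert r J)" and q: "q \<notin> insert r J" and r: "r \<notin> J"
    and dep: "\<And>z z'. (\<And>i. i \<in> insert r J \<Longrightarrow> z i = z' i) \<Longrightarrow> h z = h z'"
    and lin: "\<And>z. Vector_Spaces.linear scaleG scaleM (\<lambda>v. h (z(r := v)))"
  shows "phi_fun (insert p (insert q (insert r J))) (\<lambda>z. h (z(r := br (z p) (z q) (z r)))) z =
    phi_fun (insert r J) h (z(r := br_T scaleG br lam T (z p) (z q) (z r)))"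
    (is "phi_fun ?I ?g z = phi_fun _ h (z(r := ?w))")
proof -
  define g where "g = ?g"
  define L where "L = (\<lambda>v. rb_sum J h (z(r := v)))"
  define H where "H = (\<lambda>v. h ((twist J z)(r := v)))"
  have L: "Vector_Spaces.linear scaleG scaleM L"
    unfolding L_def by (rule linear_slot_rb_sum[OF r lin])
  have H: "Vector_Spaces.linear scaleG scaleM H"
    unfolding H_def by (rule lin)
  define y where "y = (\<lambda>a b c. z(p := a, q := b, r := c))"
  have y: "y a b c p = a" "y a b c q = b" "y a b c r = c" "(y a b c)(p := v) = y v b c"
    "(y a b c)(q := v) = y a v c" "(y a b c)(r := v) = y a b v" for a b c v
    using p q by (auto simp: y_def)
  have z: "z = y (z p) (z q) (z r)" by (simp add: y_def)
  have g_upd: "g (x(p := a, q := b, r := c)) = h (x(r := br a b c))" for x a b c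
    unfolding g_def by (rule dep) (use p q in auto)
  have tw: "twist S (y a b c) = (twist S z)(p := a, q := b, r := c)" if "S \<subseteq> J" for S a b c
    using that p q r by (auto simp: y_def twist_def fun_eq_iff)
  have gL: "rb_sum J g (y a b c) = L (br a b c)" for a b c
    unfolding L_def
  proof (rule rb_sum_cong)
    fix S assume S: "S \<subseteq> J"
    then have "r \<notin> S" using r by auto
    then show "g (twist S (y a b c)) = h (twist S (z(r := br a b c)))"
      unfolding tw[OF S] g_upd by (simp add: twist_fun_upd)
  qed
  have gH: "g (twist J (y a b c)) = H (br a b c)" for a b c
    unfolding H_def tw[OF subset_refl] g_upd ..
  let ?a = "z p" and ?b = "z q" and ?c = "z r"
  have Tw: "T ?w = br (T ?a) (T ?b) (T ?c)"
    by (simp add: rota_baxter)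
  \<comment> \<open>Stated for any linear \<open>K\<close>, to serve both \<open>L\<close> and
    \<open>H\<close>. The factor \<open>lam^2\<close> is written as two scalings, the form in which
    the recursion produces it.\<close>
  have w: "K ?w = K (br (T ?a) (T ?b) ?c) + K (br (T ?a) ?b (T ?c)) + K (br ?a (T ?b) (T ?c))
      + scaleM lam (K (br (T ?a) ?b ?c)) + scaleM lam (K (br ?a (T ?b) ?c))
      + scaleM lam (K (br ?a ?b (T ?c))) + scaleM lam (scaleM lam (K (br ?a ?b ?c)))"
    if "Vector_Spaces.linear scaleG scaleM K" for K
    by (simp add: br_T_def linear_addD[OF that] linear_scaleD[OF that] power2_eq_square)
  have "rb_sum ?I g z = rb_sum ?I g (y ?a ?b ?c)"
    by (simp flip: z)
  also have "\<dots> = L (T ?w) + H ?w + scaleM lam (L ?w)"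
    unfolding Tw w[OF L] w[OF H] rb_sum_insert[OF finite.insertI[OF finite.insertI[OF fin]] p]
      rb_sum_insert[OF finite.insertI[OF fin] q] rb_sum_insert[OF fin r]
      twist_insert[OF q] twist_insert[OF r] y gL gH
    by (simp add: M.scale_right_distrib add_ac del: M.scale_scale)
  also have "\<dots> = rb_sum (insert r J) h (z(r := ?w))"
    using fin r by (simp add: rb_sum_insert twist_fun_upd L_def H_def)
  finally have "rb_sum ?I g z = rb_sum (insert r J) h (z(r := ?w))" .
  moreover have "g (T \<circ> z) = h (T \<circ> z(r := ?w))"
    by (simp add: g_def fun_upd_comp Tw)
  ultimately show ?thesis
    by (simp add: phi_fun_def flip: g_def)
qed

text \<open>With \<open>R\<close>, \<open>H\<close> and \<open>S\<close> as named in the proof, two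
  recursion steps give \<open>\<rho> (T a) (T b) R + S H + lam S R\<close>. The Rota-Baxter identity
  for \<open>TM\<close> replaces \<open>TM\<close> of the first and third terms by
  \<open>\<rho> (T a) (T b) (TM R) - TM (S (TM R))\<close>. What remains depends only on
  \<open>H - TM R\<close>, which is \<open>phi_fun J F z\<close>.\<close>

lemma phi_fun_rho:
  assumes fin: "finite J" and pq: "p \<notin> insert q J" "q \<notin> J"
    and dep: "\<And>z z'. (\<And>i. i \<in> J \<Longrightarrow> z i = z' i) \<Longrightarrow> F z = F z'"
  shows "phi_fun (insert p (insert q J)) (\<lambda>z. \<rho> (z p) (z q) (F z)) z =
    rho_T scaleM \<rho> lam T TM (z p) (z q) (phi_fun J F z)"
    (is "phi_fun ?I ?g z = _")
proof -
  define g where "g = ?g"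
  define y where "y = (\<lambda>a b. z(p := a, q := b))"
  have y: "y a b p = a" "y a b q = b" "(y a b)(p := v) = y v b" "(y a b)(q := v) = y a v"
    for a b v
    using pq by (auto simp: y_def)
  have z: "z = y (z p) (z q)" by (simp add: y_def)
  have tw: "twist S (y a b) = (twist S z)(p := a, q := b)" if "S \<subseteq> J" for S a b
    using that pq by (auto simp: y_def twist_def fun_eq_iff)
  have g_upd: "g (x(p := a, q := b)) = \<rho> a b (F x)" for x a b
  proof -
    have "F (x(p := a, q := b)) = F x"
      by (rule dep) (use pq in auto)
    then show ?thesis using pq by (simp add: g_def)
  qed
  have gL: "rb_sum J g (y a b) = \<rho> a b (rb_sum J F z)" for a b
    unfolding rb_sum_linear[OF rho_linear3, symmetric]
    by (rule rb_sum_cong) (simp only: tw g_upd)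
  have gH: "g (twist J (y a b)) = \<rho> a b (F (twist J z))" for a b
    unfolding tw[OF subset_refl] g_upd ..
  have FT: "F (T \<circ> z) = F (twist J z)"
    by (rule dep) (simp add: twist_def)
  let ?a = "z p" and ?b = "z q" and ?R = "rb_sum J F z"
  let ?H = "F (twist J z)"
  \<comment> \<open>This is the operator under \<open>TM\<close> in \<open>rho_T\<close>; it also
    shortens the Rota-Baxter identity for the representation to \<open>rb\<close>.\<close>
  define S where "S = (\<lambda>m. \<rho> (T ?a) ?b m + \<rho> ?a (T ?b) m + scaleM lam (\<rho> ?a ?b m))"
  have S_eq: "\<rho> (T ?a) ?b m + \<rho> ?a (T ?b) m + scaleM lam (\<rho> ?a ?b m) = S m" for m
    by (simp add: S_def)
  have S_diff: "S (m - m') = S m - S m'" for m m'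
    by (simp add: S_def linear_diffD[OF rho_linear3] M.scale_right_diff_distrib)
  have rb: "\<rho> (T ?a) (T ?b) (TM m) = TM (\<rho> (T ?a) (T ?b) m + S (TM m) + scaleM lam (S m))" for m
    unfolding rota_baxter_rep S_def
    by (rule arg_cong[where f = TM])
      (simp add: M.scale_right_distrib power2_eq_square add_ac)
  have "rb_sum ?I g z = rb_sum ?I g (y ?a ?b)"
    by (simp flip: z)
  also have "\<dots> = \<rho> (T ?a) (T ?b) ?R + S ?H + scaleM lam (S ?R)"
    unfolding rb_sum_insert[OF finite.insertI[OF fin] pq(1)] rb_sum_insert[OF fin pq(2)]
      twist_insert[OF pq(2)] y gL gH
    by (simp add: S_def M.scale_right_distrib add_ac)
  finally have "phi_fun ?I ?g z =
      \<rho> (T ?a) (T ?b) ?H - TM (\<rho> (T ?a) (T ?b) ?R + S ?H + scaleM lam (S ?R))"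
    by (simp add: phi_fun_def FT g_def)
  also have "\<dots> = \<rho> (T ?a) (T ?b) ?H - \<rho> (T ?a) (T ?b) (TM ?R) - TM (S ?H - S (TM ?R))"
    unfolding rb by (simp add: linear_addD[OF TM_linear] linear_diffD[OF TM_linear] algebra_simps)
  also have "\<dots> = rho_T scaleM \<rho> lam T TM ?a ?b (phi_fun J F z)"
    unfolding rho_T_def phi_fun_def FT S_eq S_diff by (simp add: linear_diffD[OF rho_linear3])
  finally show ?thesis .
qed

section \<open>From lists of arguments to indexed families\<close>

text \<open>Grouping the proper subsets by cardinality gives the double sum. For
  \<open>n = 1\<close> the only proper subset is empty, with coefficient 1, so the separate clause
  follows the same formula.\<close>

lemma Phi_eq_sum_proper_subsets:
  assumes "n \<noteq> 0"
  shows "Phi scaleM lam T TM n f zs = f (map T zs) -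
    TM (\<Sum>S\<in>Pow {..<num_args n} - {{..<num_args n}}.
      scaleM (lam ^ (num_args n - 1 - card S)) (f (apply_at T S zs)))"
proof (cases "n = 1")
  case True
  have "Pow {..<Suc 0} - {{..<Suc 0}} = {{}}"
    by (auto simp: lessThan_Suc)
  moreover have "apply_at T {} zs = zs"
    by (simp add: apply_at_def map_nth)
  ultimately show ?thesis
    using True by (simp add: Phi_def num_args_def)
next
  case False
  define L where "L = num_args n"
  define A where "A = Pow {..<L} - {{..<L}}"
  let ?h = "\<lambda>S. scaleM (lam ^ (L - 1 - card S)) (TM (f (apply_at T S zs)))"
  have L: "2 * n - 2 = L - 1" "2 * n - 1 = L" "0 < L"
    using assms by (auto simp: L_def num_args_def)
  have card: "card S < L" if "S \<in> A" for S
    using psubset_card_mono[of "{..<L}" S] that by (auto simp: A_def)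
  \<comment> \<open>As \<open>k\<close> is at most \<open>L - 1\<close>, a subset with
    \<open>k\<close> elements cannot be all of \<open>{..<L}\<close>.\<close>
  have sub: "{S. S \<subseteq> {..<L} \<and> card S = k} = {S \<in> A. card S = k}" if "k \<in> {0..L - 1}" for k
    using that L(3) by (auto simp: A_def)
  have "(\<Sum>k = 0..L - 1. scaleM (lam ^ (L - 1 - k))
      (\<Sum>S\<in>{S. S \<subseteq> {..<L} \<and> card S = k}. TM (f (apply_at T S zs)))) =
    (\<Sum>k = 0..L - 1. sum ?h {S \<in> A. card S = k})"
    by (rule sum.cong) (auto simp: sub M.scale_sum_right intro!: sum.cong)
  also have "\<dots> = sum ?h A"
  proof (rule sum.group)
    show "card ` A \<subseteq> {0..L - 1}"
      using card by fastforce
  qed (simp_all add: A_def)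
  also have "\<dots> = TM (\<Sum>S\<in>A. scaleM (lam ^ (L - 1 - card S)) (f (apply_at T S zs)))"
    by (simp add: linear_sumD[OF TM_linear] linear_scaleD[OF TM_linear])
  finally show ?thesis
    using assms False unfolding Phi_def L A_def L_def[symmetric] by simp
qed

text \<open>Subsets of positions correspond to subsets of \<open>set idx\<close>, since
  \<open>idx\<close> has no repetitions. The list \<open>idx\<close> may select part of a larger
  family, so cochains of degrees \<open>n\<close> and \<open>n + 1\<close> can be evaluated on the
  same \<open>z\<close>.\<close>

lemma Phi_map:
  assumes n: "n \<noteq> 0" and idx: "distinct idx" "length idx = num_args n"
  shows "Phi scaleM lam T TM n f (map z idx) = phi_fun (set idx) (\<lambda>z. f (map z idx)) z"
proof -
  let ?N = "{..<num_args n}"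
  have bij: "bij_betw ((!) idx) ?N (set idx)"
    by (rule bij_betw_nth) (use idx in auto)
  have inj: "inj_on ((!) idx) ?N" and img: "(!) idx ` ?N = set idx"
    using bij by (auto simp: bij_betw_def)
  have bijP: "bij_betw ((`) ((!) idx)) (Pow ?N - {?N}) (Pow (set idx) - {set idx})"
  proof (rule bij_betw_DiffI[OF bij_betw_Pow[OF bij]])
    show "bij_betw ((`) ((!) idx)) {?N} {set idx}"
      unfolding bij_betw_def using img by simp
  qed auto
  have card: "card (set idx) = num_args n"
    using idx by (simp add: distinct_card)
  have tw: "apply_at T S (map z idx) = map (twist ((!) idx ` S) z) idx" if "S \<subseteq> ?N" for S
  proof (rule nth_equalityI)
    fix i assume "i < length (apply_at T S (map z idx))"
    then have "i < length idx" by (simp add: apply_at_def)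
    then show "apply_at T S (map z idx) ! i = map (twist ((!) idx ` S) z) idx ! i"
      using inj_on_image_mem_iff[OF inj _ that, of i] idx(2)
      by (simp add: apply_at_def twist_def)
  qed (simp add: apply_at_def)
  have "rb_sum (set idx) (\<lambda>z. f (map z idx)) z =
      (\<Sum>S\<in>Pow ?N - {?N}. scaleM (lam ^ (num_args n - 1 - card ((!) idx ` S)))
        (f (map (twist ((!) idx ` S) z) idx)))"
    unfolding rb_sum_def card by (rule sum.reindex_bij_betw[OF bijP, symmetric])
  also have "\<dots> = (\<Sum>S\<in>Pow ?N - {?N}.
      scaleM (lam ^ (num_args n - 1 - card S)) (f (apply_at T S (map z idx))))"
  proof (rule sum.cong[OF refl])
    fix S assume "S \<in> Pow ?N - {?N}"
    then have S: "S \<subseteq> ?N" by auto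
    show "scaleM (lam ^ (num_args n - 1 - card ((!) idx ` S))) (f (map (twist ((!) idx ` S) z) idx))
      = scaleM (lam ^ (num_args n - 1 - card S)) (f (apply_at T S (map z idx)))"
      unfolding tw[OF S] card_image[OF inj_on_subset[OF inj S]] ..
  qed
  finally have sum: "rb_sum (set idx) (\<lambda>z. f (map z idx)) z =
    (\<Sum>S\<in>Pow ?N - {?N}. scaleM (lam ^ (num_args n - 1 - card S)) (f (apply_at T S (map z idx))))" .
  show ?thesis
    unfolding Phi_eq_sum_proper_subsets[OF n] phi_fun_def sum map_map ..
qed

text \<open>Distinctness of \<open>idx\<close> makes \<open>r\<close> occur at exactly one position,
  so the update changes a single argument.\<close>

lemma cochain_slot_linear:
  assumes f: "f \<in> cochains scaleG scaleM n" and idx: "distinct idx" "length idx = num_args n"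
    and r: "r \<in> set idx"
  shows "Vector_Spaces.linear scaleG scaleM (\<lambda>v. f (map (z(r := v)) idx))"
proof -
  obtain k where k: "k < length idx" "r = idx ! k"
    using r by (auto simp: in_set_conv_nth)
  have "map (z(r := v)) idx = (map z idx)[k := v]" for v
    using k idx(1) by (intro nth_equalityI) (auto simp: nth_list_update nth_eq_iff_index_eq)
  then show ?thesis
    using f k idx(2) by (simp add: cochains_def)
qed

text \<open>Matches a bracket summand of the coboundary over \<open>br_T\<close> with
  \<open>phi_fun\<close> of the corresponding summand over \<open>br\<close>; \<open>p\<close> and
  \<open>q\<close> index the omitted pair.\<close>

lemma Phi_bracket:
  assumes n: "n \<noteq> 0" and f: "f \<in> cochains scaleG scaleM n"
    and idx: "distinct idx" "length idx = num_args n"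
    and pqr: "p \<noteq> q" "p \<notin> set idx" "q \<notin> set idx" "r \<in> set idx"
  shows "Phi scaleM lam T TM n f (map (z(r := br_T scaleG br lam T (z p) (z q) (z r))) idx) =
    phi_fun (insert p (insert q (set idx)))
      (\<lambda>z. f (map (z(r := br (z p) (z q) (z r))) idx)) z"
proof -
  define J where "J = set idx - {r}"
  have J: "set idx = insert r J" "r \<notin> J" "finite J"
    using pqr by (auto simp: J_def)
  show ?thesis
    unfolding Phi_map[OF n idx] unfolding J(1)
  proof (rule phi_fun_bracket[symmetric, where h = "\<lambda>z. f (map z idx)"])
    show "f (map z idx) = f (map z' idx)" if "\<And>i. i \<in> insert r J \<Longrightarrow> z i = z' i" for z z'
      using that J(1) by (intro arg_cong[where f = f]) simp
    show "Vector_Spaces.linear scaleG scaleM (\<lambda>v. f (map (z(r := v)) idx))" for z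
      by (rule cochain_slot_linear[OF f idx pqr(4)])
  qed (use pqr J in auto)
qed

lemma Phi_rho:
  assumes n: "n \<noteq> 0" and idx: "distinct idx" "length idx = num_args n"
    and pq: "p \<noteq> q" "p \<notin> set idx" "q \<notin> set idx"
  shows "rho_T scaleM \<rho> lam T TM (z p) (z q) (Phi scaleM lam T TM n f (map z idx)) =
    phi_fun (insert p (insert q (set idx))) (\<lambda>z. \<rho> (z p) (z q) (f (map z idx))) z"
  unfolding Phi_map[OF n idx]
  by (rule phi_fun_rho[symmetric]) (use pq in \<open>auto intro: arg_cong[where f = f]\<close>)

lemma Phi_wrong_length:
  assumes "\<And>zs. length zs \<noteq> num_args n \<Longrightarrow> f zs = 0" "length zs \<noteq> num_args n"
  shows "Phi scaleM lam T TM n f zs = 0"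
proof (cases "n = 0")
  case True
  then show ?thesis using assms by (simp add: Phi_def)
next
  case False
  show ?thesis
    unfolding Phi_eq_sum_proper_subsets[OF False]
    using assms by (simp add: apply_at_def linear_zeroD[OF TM_linear])
qed

section \<open>Compatibility with the coboundaries\<close>

lemma coboundary_Phi:
  assumes f: "f \<in> cochains scaleG scaleM n"
  shows "coboundary (br_T scaleG br lam T) scaleM (rho_T scaleM \<rho> lam T TM) n
      (Phi scaleM lam T TM n f) =
    Phi scaleM lam T TM (n + 1) (coboundary br scaleM \<rho> n f)"
    (is "?l = ?r")
proof
  fix zs :: "'g list"
  consider "n = 0" | "length zs \<noteq> num_args (n + 1)" | "n \<noteq> 0" "length zs = 2 * n + 1"
    by (auto simp: num_args_def)
  then show "?l zs = ?r zs"
  proof cases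
    case 1
    then show ?thesis
      by (simp add: coboundary_def Phi_def linear_zeroD[OF TM_linear])
  next
    case 2
    then have "?r zs = 0"
      by (intro Phi_wrong_length) (auto simp: coboundary_def)
    then show ?thesis
      using 2 by (simp add: coboundary_def)
  next
    case 3
    define z where "z = (!) zs"
    define w where "w = (\<lambda>j. [0..<2 * j - 2] @ [2 * j..<2 * n + 1])"
    have w_eq: "[0..<2 * j - 2] @ [2 * j..<2 * n + 1] = w j" for j
      by (simp only: w_def)
    have zs: "zs = map z [0..<2 * n + 1]"
      unfolding z_def using 3 by (metis map_nth)
    have idx: "distinct [0..<2 * n + 1]" "length [0..<2 * n + 1] = num_args (n + 1)"
      by (auto simp: num_args_def)
    \<comment> \<open>The indices of the omitted pair, adjoined to \<open>w j\<close>, recover the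
      whole index set, so every summand becomes a \<open>phi_fun\<close> over the same set.\<close>
    have w: "distinct (w j)" "length (w j) = num_args n"
      "insert (2 * j - 2) (insert (2 * j - 1) (set (w j))) = {0..<2 * n + 1}"
      "2 * j - 2 \<noteq> 2 * j - 1" "2 * j - 2 \<notin> set (w j)" "2 * j - 1 \<notin> set (w j)"
      if "1 \<le> j" "j \<le> n" for j
      using that by (auto simp: w_def num_args_def)
    \<comment> \<open>Here \<open>r\<close> will be \<open>2*k-2\<close> or \<open>2*k-1\<close>
      with \<open>j < k\<close>, or \<open>2*n\<close>; the bound \<open>2*j \<le> r\<close> ensures
      that \<open>r\<close> survives the omission.\<close>
    have bracket: "Phi scaleM lam T TM n f
        (map (z(r := br_T scaleG br lam T (z (2*j-2)) (z (2*j-1)) (z r))) (w j)) =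
      phi_fun {0..<2 * n + 1} (\<lambda>z. f (map (z(r := br (z (2*j-2)) (z (2*j-1)) (z r))) (w j))) z"
      if "1 \<le> j" "j \<le> n" "2 * j \<le> r" "r \<le> 2 * n" for j r
    proof -
      have "r \<in> set (w j)" using that by (auto simp: w_def)
      from Phi_bracket[OF 3(1) f w(1,2,4-6)[OF that(1,2)] this, of z] show ?thesis
        unfolding w(3)[OF that(1,2)] .
    qed
    have rho: "rho_T scaleM \<rho> lam T TM (z (2*j-2)) (z (2*j-1)) (Phi scaleM lam T TM n f (map z (w j))) =
      phi_fun {0..<2 * n + 1} (\<lambda>z. \<rho> (z (2*j-2)) (z (2*j-1)) (f (map z (w j)))) z"
      if "1 \<le> j" "j \<le> n" for j
      using Phi_rho[OF 3(1) w(1,2,4-6)[OF that], of z f] w(3)[OF that] by simp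
    \<comment> \<open>In the last two summands two of the three final indices feed the action, and
      the third is the last argument of \<open>f\<close>.\<close>
    have last1: "rho_T scaleM \<rho> lam T TM (z (2*n-1)) (z (2*n))
        (Phi scaleM lam T TM n f (map z ([0..<2*n-2] @ [2*n-2]))) =
      phi_fun {0..<2 * n + 1} (\<lambda>z. \<rho> (z (2*n-1)) (z (2*n)) (f (map z ([0..<2*n-2] @ [2*n-2])))) z"
    proof -
      let ?idx = "[0..<2*n-2] @ [2*n-2]"
      have side: "distinct ?idx" "length ?idx = num_args n" "2*n-1 \<noteq> 2*n"
        "2*n-1 \<notin> set ?idx" "2*n \<notin> set ?idx"
        "insert (2*n-1) (insert (2*n) (set ?idx)) = {0..<2 * n + 1}"
        using 3(1) by (auto simp: num_args_def)
      show ?thesis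
        using Phi_rho[OF 3(1) side(1-5), of z f] unfolding side(6) .
    qed
    have last2: "rho_T scaleM \<rho> lam T TM (z (2*n)) (z (2*n-2))
        (Phi scaleM lam T TM n f (map z ([0..<2*n-2] @ [2*n-1]))) =
      phi_fun {0..<2 * n + 1} (\<lambda>z. \<rho> (z (2*n)) (z (2*n-2)) (f (map z ([0..<2*n-2] @ [2*n-1])))) z"
    proof -
      let ?idx = "[0..<2*n-2] @ [2*n-1]"
      have side: "distinct ?idx" "length ?idx = num_args n" "2*n \<noteq> 2*n-2"
        "2*n \<notin> set ?idx" "2*n-2 \<notin> set ?idx"
        "insert (2*n) (insert (2*n-2) (set ?idx)) = {0..<2 * n + 1}"
        using 3(1) by (auto simp: num_args_def)
      show ?thesis
        using Phi_rho[OF 3(1) side(1-5), of z f] unfolding side(6) .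
    qed
    have r: "?r zs = phi_fun {0..<2 * n + 1}
        (\<lambda>z. coboundary br scaleM \<rho> n f (map z [0..<2 * n + 1])) z"
      unfolding zs by (subst Phi_map[OF _ idx]) (simp_all del: upt_Suc)
    show ?thesis
      \<comment> \<open>Linearity of \<open>phi_fun\<close> in its function distributes it over the
        coboundary, after which the summands agree one by one.\<close>
      unfolding r unfolding zs coboundary_map_upt[OF 3(1)] phi_fun_add phi_fun_sum phi_fun_scale
        w_eq last1 last2
      by (intro arg_cong2[where f = "(+)"] sum.cong refl arg_cong[where f = "scaleM _"] bracket rho)
        auto
  qed
qed

section \<open>Well-definedness and linearity on cochains\<close>

lemma Phi_in_cochains:
  assumes f: "f \<in> cochains scaleG scaleM n"
  shows "Phi scaleM lam T TM n f \<in> cochains scaleG scaleM n"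
proof (cases "n = 0")
  case True
  then show ?thesis using f by (simp add: Phi_def)
next
  case False
  define N where "N = num_args n"
  define g where "g = (\<lambda>z. f (map z [0..<N]))"
  have idx: "distinct [0..<N]" "length [0..<N] = num_args n"
    by (auto simp: N_def)
  have Phi: "Phi scaleM lam T TM n f (map z [0..<N]) = phi_fun {0..<N} g z" for z
    unfolding Phi_map[OF False idx] g_def by simp
  have lin: "Vector_Spaces.linear scaleG scaleM (\<lambda>v. g (z(i := v)))" if "i < N" for z i
    unfolding g_def by (rule cochain_slot_linear[OF f idx]) (use that in simp)
  have "Phi scaleM lam T TM n f zs = 0" if "length zs \<noteq> num_args n" for zs
    using f that by (intro Phi_wrong_length) (auto simp: cochains_def)
  moreover have "Vector_Spaces.linear scaleG scaleM (\<lambda>z. Phi scaleM lam T TM n f (zs[i := z]))"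
    if "length zs = N" "i < N" for zs i
  proof -
    have "zs[i := v] = map (((!) zs)(i := v)) [0..<N]" for v
      using that by (metis map_nth map_upt_list_update)
    then show ?thesis
      using linear_slot_phi_fun[of "{0..<N}" i g] lin that by (simp add: Phi)
  qed
  moreover have "Phi scaleM lam T TM n f zs = 0"
    if "length zs = N" "same_factor n i j" "zs ! i = zs ! j" for zs i j
  proof -
    have ij: "i < j" "j < N" using that(2) by (auto simp: same_factor_def N_def)
    have alt: "g (z(i := v, j := v)) = 0" for z v
    proof -
      let ?zs = "map (z(i := v, j := v)) [0..<N]"
      have "length ?zs = num_args n" "?zs ! i = ?zs ! j"
        using ij by (auto simp: N_def)
      then show ?thesis
        using f that(2) unfolding g_def cochains_def by blast
    qed
    have add: "g (z(i := u + u', j := v)) = g (z(i := u, j := v)) + g (z(i := u', j := v))"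
      "g (z(i := v, j := u + u')) = g (z(i := v, j := u)) + g (z(i := v, j := u'))" for z u u' v
      using linear_addD[OF lin[of i "z(j := v)"]] linear_addD[OF lin[of j "z(i := v)"]] ij
      by (auto simp: fun_upd_twist)
    have skew: "g (z(i := u, j := v)) + g (z(i := v, j := u)) = 0" for z u v
    proof -
      \<comment> \<open>Polarisation: alternation removes the two diagonal terms here, and the left
        side in the next line.\<close>
      have "g (z(i := u + v, j := u + v)) = g (z(i := u, j := v)) + g (z(i := v, j := u))"
        unfolding add(2) by (simp add: add(1) alt add.commute)
      then show ?thesis by (simp only: alt)
    qed
    have "Phi scaleM lam T TM n f (map ((!) zs) [0..<N]) = 0"
      unfolding Phi
      by (rule phi_fun_alternating[where i = i and j = j])
        (use ij that(3) in \<open>simp_all only: alt skew, auto\<close>)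
    then show ?thesis
      using that(1) by (metis map_nth)
  qed
  ultimately show ?thesis
    by (auto simp: cochains_def N_def)
qed

lemma Phi_add:
  "Phi scaleM lam T TM n (\<lambda>z. f z + g z) =
    (\<lambda>z. Phi scaleM lam T TM n f z + Phi scaleM lam T TM n g z)"
  by (rule ext, cases "n = 0")
    (simp_all add: Phi_def linear_addD[OF TM_linear] sum.distrib M.scale_right_distrib)

lemma Phi_scale:
  "Phi scaleM lam T TM n (\<lambda>z. scaleM c (f z)) = (\<lambda>z. scaleM c (Phi scaleM lam T TM n f z))"
proof (cases "n = 0")
  case True
  then show ?thesis by (simp add: Phi_def)
next
  case False
  show ?thesis
    unfolding Phi_eq_sum_proper_subsets[OF False] M.scale_right_diff_distrib
      linear_scaleD[OF TM_linear, symmetric] M.scale_sum_right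
    by (simp add: mult.commute)
qed

end

theorem proposition3p2:
  fixes scaleG :: "'k::field_char_0 \<Rightarrow> 'g::ab_group_add \<Rightarrow> 'g"
    and br :: "'g \<Rightarrow> 'g \<Rightarrow> 'g \<Rightarrow> 'g"
    and lam :: 'k
    and T :: "'g \<Rightarrow> 'g"
    and scaleM :: "'k \<Rightarrow> 'm::ab_group_add \<Rightarrow> 'm"
    and \<rho> :: "'g \<Rightarrow> 'g \<Rightarrow> 'm \<Rightarrow> 'm"
    and TM :: "'m \<Rightarrow> 'm"
  assumes "rota_baxter_three_lie_algebra scaleG br lam T"
    and "rota_baxter_three_lie_representation scaleG br lam T scaleM \<rho> TM"
  shows "cochain_map scaleM
           (cochains scaleG scaleM) (coboundary br scaleM \<rho>)
           (cochains scaleG scaleM)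
           (coboundary (br_T scaleG br lam T) scaleM (rho_T scaleM \<rho> lam T TM))
           (Phi scaleM lam T TM)"
proof -
  interpret rota_baxter_three_lie_representation scaleG br lam T scaleM \<rho> TM
    by (rule assms(2))
  show ?thesis
    unfolding cochain_map_def
    using Phi_in_cochains Phi_add Phi_scale coboundary_Phi by blast
qed

end
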